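(* Let $\mathcal{R}_i^{(3)}$, $i\ge1$, be the length of the $i$-th zero run of the sequence $T_n\bmod 3$, where $T_n=\frac{1}{n+1}\binom{3n+1}{n}$ for $n\ge0$. The set of values attained by the left-to-right maxima of the sequence $\langle\mathcal{R}_i^{(3)}\rangle_{i\ge1}$ is $$\left\{\frac{3^r-1}{2}:r\ge1\right\}\cup\left\{3^r-1:r\ge1\right\}.$$
   Context: For a prime $p$, a zero run of $T_n\bmod p$ is a maximal (nonempty) interval of consecutive indices $n\ge 0$ on which $T_n\equiv 0\pmod p$. Zero runs are numbered from left to right starting with $1$, and $\mathcal{R}_i^{(p)}$ denotes the length (number of indices) of the $i$-th zero run. For a sequence $\langle a_i\rangle_{i\ge1}$, the entry $a_k$ is a left-to-right maximum (record) if $a_k\ge a_i$ for every $i<k$ (ties are allowed). *)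

theory Defs
  imports Main "HOL-Library.Infinite_Set"
begin

definition T :: "nat \<Rightarrow> nat" where
  "T n = ((3 * n + 1) choose n) div (n + 1)"

text \<open>The division in \<^const>\<open>T\<close> is exact.\<close>

lemma T_mult: "(n + 1) * T n = (3 * n + 1) choose n"
proof -
  have eq: "(n + 1) * ((3 * n + 1) choose (n + 1)) = (2 * n + 1) * ((3 * n + 1) choose n)"
    using binomial_absorb_comp[of "3 * n + 1" n] binomial_absorption[of n "3 * n + 1"]
    by (simp del: binomial_Suc_Suc mult_Suc)
  have "coprime (n + 1) (2 * n + 1)"
  proof (rule coprimeI)
    fix c assume c: "c dvd n + 1" "c dvd 2 * n + 1"
    then have "c dvd 2 * (n + 1) - (2 * n + 1)" by (intro dvd_diff_nat dvd_mult)
    then show "is_unit c" by simp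
  qed
  moreover have "(n + 1) dvd (2 * n + 1) * ((3 * n + 1) choose n)"
    unfolding eq[symmetric] by (rule dvd_triv_left)
  ultimately have "(n + 1) dvd ((3 * n + 1) choose n)"
    using coprime_dvd_mult_right_iff by blast
  then show ?thesis unfolding T_def by (rule dvd_mult_div_cancel)
qed

definition zero_interval :: "nat \<Rightarrow> nat set \<Rightarrow> bool" where
  "zero_interval p I \<longleftrightarrow>
     I \<noteq> {} \<and> (\<forall>a\<in>I. \<forall>b\<in>I. {a..b} \<subseteq> I) \<and> (\<forall>n\<in>I. T n mod p = 0)"

definition zero_run :: "nat \<Rightarrow> nat set \<Rightarrow> bool" where
  "zero_run p I \<longleftrightarrow> zero_interval p I \<and> (\<forall>J. zero_interval p J \<and> I \<subseteq> J \<longrightarrow> J = I)"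

text \<open>Distinct zero runs are disjoint, so the left-to-right order is the order of their
  least elements, which are listed increasingly (starting with index \<open>0\<close>) by
  \<open>enumerate\<close>. The length is meaningful for \<open>i \<ge> 1\<close>, provided there are
  infinitely many zero runs; each of them is then finite.\<close>

definition ith_zero_run :: "nat \<Rightarrow> nat \<Rightarrow> nat set" where
  "ith_zero_run p i =
     (THE I. zero_run p I \<and>
        (LEAST n. n \<in> I) = enumerate {LEAST n. n \<in> J | J. zero_run p J} (i - 1))"

definition zero_run_length :: "nat \<Rightarrow> nat \<Rightarrow> nat" where
  "zero_run_length p i = card (ith_zero_run p i)"

text \<open>Sequences are indexed from \<open>1\<close>; the value at index \<open>0\<close> is ignored.\<close>

definition left_to_right_max :: "(nat \<Rightarrow> 'a::linorder) \<Rightarrow> nat \<Rightarrow> bool" where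
  "left_to_right_max a k \<longleftrightarrow> k \<ge> 1 \<and> (\<forall>i. 1 \<le> i \<and> i < k \<longrightarrow> a k \<ge> a i)"

end

theory Submission
  imports Defs "HOL-Computational_Algebra.Primes"
begin

text \<open>
  Comparing the 3-adic valuations of the factorials in \<open>T n = (3n+1)! / ((n+1)! (2n+1)!)\<close> shows
  that \<open>T (3m+2)\<close> is divisible by 3 iff \<open>T m\<close> is, that \<open>T (3m)\<close> is divisible by 3 for \<open>m > 0\<close>, and
  that \<open>T (3m+1)\<close> is not divisible by 3 iff \<open>2m+1\<close> is a power of 3. Hence \<open>T n\<close> is not divisible
  by 3 iff the ternary expansion of \<open>n\<close> consists of ones followed by twos, which means
  \<open>2 (n + 1) = 3^r + 3^b\<close> with \<open>b \<le> r\<close>. In increasing order these indices are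
  \<open>(r, 0), \<dots>, (r, r), (r + 1, 0), \<dots>\<close>; the gap after \<open>(r, b)\<close> has length \<open>3^b - 1\<close> if \<open>b < r\<close>, and
  \<open>(3^r - 1) / 2\<close> if \<open>b = r\<close>. So every run length has one of the two claimed forms, and the gaps
  after \<open>(r, r)\<close> and \<open>(b + 1, b)\<close> are at least as long as every earlier one.
\<close>

section \<open>The 3-adic valuation\<close>

text \<open>The multiples of 3 among the factors of \<open>fact n\<close> are \<open>3 * 1\<close>,
  ..., \<open>3 * m\<close>; together they contribute \<open>m\<close> factors 3 and those of
  \<open>fact m\<close>.\<close>

lemma multiplicity_3_fact:
  assumes "n = 3 * m + c" "c < 3"
  shows "multiplicity 3 (fact n :: nat) = m + multiplicity 3 (fact m :: nat)"
proof -
  have p: "prime_elem (3::nat)" by simp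
  have nd: "multiplicity 3 (3 * m + c) = 0" if "0 < c" "c < 3" for m c :: nat
    using that by (intro not_dvd_imp_multiplicity_0) presburger
  have mult3: "multiplicity 3 (3 * Suc m) = Suc (multiplicity 3 (Suc m))" for m :: nat
    by (subst multiplicity_times_same) auto
  have base: "multiplicity 3 (fact (3 * m) :: nat) = m + multiplicity 3 (fact m :: nat)" for m
  proof (induction m)
    case (Suc m)
    have "(fact (3 * Suc m) :: nat) = (3 * Suc m) * ((3 * m + 2) * ((3 * m + 1) * fact (3 * m)))"
      by (simp add: eval_nat_numeral algebra_simps)
    also have "multiplicity 3 \<dots> = Suc (multiplicity 3 (Suc m)) + multiplicity 3 (fact (3 * m) :: nat)"
      by (simp add: prime_elem_multiplicity_mult_distrib[OF p] mult3 nd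
          del: mult_Suc mult_Suc_right add_2_eq_Suc' add_2_eq_Suc One_nat_def)
    also have "\<dots> = Suc m + multiplicity 3 (fact (Suc m) :: nat)"
      unfolding Suc.IH fact_Suc of_nat_id
      by (subst prime_elem_multiplicity_mult_distrib[OF p]) auto
    finally show ?case .
  qed simp
  consider "c = 0" | "c = 1" | "c = 2" using assms by linarith
  then have "multiplicity 3 (fact (3 * m + c) :: nat) = m + multiplicity 3 (fact m :: nat)"
  proof cases
    case 2
    have "(fact (3 * m + 1) :: nat) = (3 * m + 1) * fact (3 * m)" by simp
    then show ?thesis unfolding 2
      by (simp add: prime_elem_multiplicity_mult_distrib[OF p] nd base del: One_nat_def)
  next
    case 3
    have "(fact (3 * m + 2) :: nat) = (3 * m + 2) * ((3 * m + 1) * fact (3 * m))"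
      by (simp add: eval_nat_numeral)
    then show ?thesis unfolding 3
      by (simp add: prime_elem_multiplicity_mult_distrib[OF p] nd base
          del: One_nat_def add_2_eq_Suc' add_2_eq_Suc)
  qed (simp add: base)
  then show ?thesis using assms by simp
qed

text \<open>By Legendre's formula, \<open>n\<close> minus twice the valuation is the ternary digit
  sum of \<open>n\<close>, which is at least 1 for positive \<open>n\<close>. The induction strips
  the last digit.\<close>

lemma multiplicity_3_fact_bound:
  "n > 0 \<Longrightarrow> 2 * multiplicity 3 (fact n :: nat) + 1 \<le> n"
proof (induction n rule: less_induct)
  case (less n)
  have "multiplicity 3 (fact n :: nat) = n div 3 + multiplicity 3 (fact (n div 3) :: nat)"
    using multiplicity_3_fact[of n "n div 3" "n mod 3"] by simp
  moreover have "2 * multiplicity 3 (fact (n div 3) :: nat) + 1 \<le> n div 3" if "n div 3 > 0"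
    using less.IH[of "n div 3"] that by simp
  moreover have "3 * (n div 3) \<le> n" by simp
  ultimately show ?case using less.prems
    by (cases "n div 3 = 0") auto
qed

text \<open>Equality means ternary digit sum 1, that is, a digit 1 followed by zeros.\<close>

lemma multiplicity_3_fact_sharp_iff:
  "2 * multiplicity 3 (fact n :: nat) + 1 = n \<longleftrightarrow> (\<exists>r. n = 3 ^ r)"
proof (induction n rule: less_induct)
  case (less n)
  define j c where "j = n div 3" and "c = n mod 3"
  have n: "n = 3 * j + c" and c: "c < 3" by (simp_all add: j_def c_def)
  have v: "multiplicity 3 (fact n :: nat) = j + multiplicity 3 (fact j :: nat)"
    by (rule multiplicity_3_fact[OF n c])
  show ?case
  proof (cases "j = 0")
    case True
    have "n = 1" if "n = 3 ^ r" for r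
      using that True c n by (cases r) auto
    moreover have "(1::nat) = 3 ^ 0" by simp
    moreover have "multiplicity 3 (fact n :: nat) = 0" using v True by simp
    ultimately show ?thesis by (metis add_0 mult_0_right)
  next
    case False
    \<comment> \<open>The left side is at most \<open>2 * j + j\<close> by the bound for
      \<open>j\<close>, so equality with \<open>3 * j + c\<close> forces \<open>c = 0\<close> and
      sharpness at \<open>j\<close>.\<close>
    have "2 * multiplicity 3 (fact n :: nat) + 1 = n \<longleftrightarrow>
        c = 0 \<and> 2 * multiplicity 3 (fact j :: nat) + 1 = j"
      using multiplicity_3_fact_bound[of j] False v n by auto
    also have "\<dots> \<longleftrightarrow> c = 0 \<and> (\<exists>r. j = 3 ^ r)"
      using less.IH[of j] False n by auto
    also have "\<dots> \<longleftrightarrow> (\<exists>r. n = 3 ^ r)"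
    proof
      assume "c = 0 \<and> (\<exists>r. j = 3 ^ r)"
      then show "\<exists>r. n = 3 ^ r" using n by (metis add_0_right power_Suc)
    next
      assume "\<exists>r. n = 3 ^ r"
      then obtain r where r: "n = 3 ^ r" by blast
      with False have "r \<noteq> 0" using n by (cases r) auto
      then obtain q where "n = 3 * 3 ^ q" using r by (cases r) auto
      then have "c = 0" "j = 3 ^ q" unfolding c_def j_def by simp_all
      then show "c = 0 \<and> (\<exists>r. j = 3 ^ r)" by blast
    qed
    finally show ?thesis .
  qed
qed

section \<open>The valuation of \<open>T n\<close>\<close>

lemma T_mult_facts: "T n * fact (n + 1) * fact (2 * n + 1) = fact (3 * n + 1)"
proof -
  have "fact n * fact (2 * n + 1) * ((3 * n + 1) choose n) = (fact (3 * n + 1) :: nat)"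
    using binomial_fact_lemma[of n "3 * n + 1"] by (simp add: Suc_diff_le)
  then show ?thesis
    unfolding T_mult[symmetric] by (simp add: algebra_simps)
qed

text \<open>Valuations are taken in \<open>T_mult_facts\<close>; the additive form avoids truncated
  subtraction.\<close>

lemma multiplicity_3_T:
  "multiplicity 3 (T n) + multiplicity 3 (fact (n + 1) :: nat) + multiplicity 3 (fact (2 * n + 1) :: nat)
    = n + multiplicity 3 (fact n :: nat)"
proof -
  have p: "prime_elem (3::nat)" by simp
  have T0: "T n \<noteq> 0" using T_mult_facts[of n] by (metis fact_nonzero mult_zero_left)
  have "multiplicity 3 (T n * fact (n + 1) * fact (2 * n + 1)) = multiplicity 3 (T n)
      + multiplicity 3 (fact (n + 1) :: nat) + multiplicity 3 (fact (2 * n + 1) :: nat)"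
    using T0 by (simp add: prime_elem_multiplicity_mult_distrib[OF p] del: fact_Suc)
  then show ?thesis
    unfolding T_mult_facts using multiplicity_3_fact[of "3 * n + 1" n 1] by simp
qed

lemma T_mod_3_iff: "T n mod 3 \<noteq> 0 \<longleftrightarrow> multiplicity 3 (T n) = 0"
proof -
  have "T n \<noteq> 0" using T_mult_facts[of n] by (metis fact_nonzero mult_zero_left)
  then show ?thesis by (simp add: multiplicity_eq_zero_iff mod_eq_0_iff_dvd)
qed

text \<open>The valuation of \<open>T (3 * m)\<close> is \<open>m\<close> minus that of
  \<open>fact (2 * m)\<close>, which is positive by the factorial bound.\<close>

lemma T_3m_mod_3:
  assumes "m > 0"
  shows "T (3 * m) mod 3 = 0"
proof -
  have "multiplicity 3 (fact (3 * m) :: nat) = (m) + multiplicity 3 (fact (m) :: nat)"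
    by (rule multiplicity_3_fact[of _ _ 0]) simp_all
  moreover have "multiplicity 3 (fact (3 * m + 1) :: nat) = (m) + multiplicity 3 (fact (m) :: nat)"
    by (rule multiplicity_3_fact[of _ _ 1]) simp_all
  moreover have "multiplicity 3 (fact (2 * (3 * m) + 1) :: nat) = (2 * m) + multiplicity 3 (fact (2 * m) :: nat)"
    by (rule multiplicity_3_fact[of _ _ 1]) simp_all
  ultimately have "multiplicity 3 (T (3 * m)) \<noteq> 0"
    using multiplicity_3_T[of "3 * m"] multiplicity_3_fact_bound[of "2 * m"] assms by linarith
  then show ?thesis using T_mod_3_iff[of "3 * m"] by simp
qed

text \<open>The valuation of \<open>T (3 * m + 1)\<close> is \<open>m\<close> minus that of
  \<open>fact (2 * m + 1)\<close>; it vanishes exactly when the factorial bound is sharp at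
  \<open>2 * m + 1\<close>.\<close>

lemma T_3m_1_mod_3: "T (3 * m + 1) mod 3 \<noteq> 0 \<longleftrightarrow> (\<exists>r. 2 * m + 1 = 3 ^ r)"
proof -
  have "multiplicity 3 (fact (3 * m + 1) :: nat) = (m) + multiplicity 3 (fact (m) :: nat)"
    by (rule multiplicity_3_fact[of _ _ 1]) simp_all
  moreover have "multiplicity 3 (fact (3 * m + 1 + 1) :: nat) = (m) + multiplicity 3 (fact (m) :: nat)"
    by (rule multiplicity_3_fact[of _ _ 2]) simp_all
  moreover have "multiplicity 3 (fact (2 * (3 * m + 1) + 1) :: nat) = (2 * m + 1) + multiplicity 3 (fact (2 * m + 1) :: nat)"
    by (rule multiplicity_3_fact[of _ _ 0]) simp_all
  ultimately have "multiplicity 3 (T (3 * m + 1)) + multiplicity 3 (fact (2 * m + 1) :: nat) = m"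
    using multiplicity_3_T[of "3 * m + 1"] by linarith
  then have "multiplicity 3 (T (3 * m + 1)) = 0 \<longleftrightarrow>
      2 * multiplicity 3 (fact (2 * m + 1) :: nat) + 1 = 2 * m + 1" by linarith
  then show ?thesis unfolding T_mod_3_iff multiplicity_3_fact_sharp_iff .
qed

text \<open>Reducing all factorials by one ternary digit turns the valuation identity for
  \<open>3 * m + 2\<close> into the one for \<open>m\<close>.\<close>

lemma T_3m_2_mod_3: "T (3 * m + 2) mod 3 \<noteq> 0 \<longleftrightarrow> T m mod 3 \<noteq> 0"
proof -
  have "multiplicity 3 (fact (3 * m + 2) :: nat) = (m) + multiplicity 3 (fact (m) :: nat)"
    by (rule multiplicity_3_fact[of _ _ 2]) simp_all
  moreover have "multiplicity 3 (fact (3 * m + 2 + 1) :: nat) = (m + 1) + multiplicity 3 (fact (m + 1) :: nat)"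
    by (rule multiplicity_3_fact[of _ _ 0]) simp_all
  moreover have "multiplicity 3 (fact (2 * (3 * m + 2) + 1) :: nat) = (2 * m + 1) + multiplicity 3 (fact (2 * m + 1) :: nat)"
    by (rule multiplicity_3_fact[of _ _ 2]) simp_all
  ultimately have "multiplicity 3 (T (3 * m + 2)) = multiplicity 3 (T m)"
    using multiplicity_3_T[of "3 * m + 2"] multiplicity_3_T[of m] by linarith
  then show ?thesis by (simp only: T_mod_3_iff)
qed

lemma T_0: "T 0 = 1"
  by (simp add: T_def)

text \<open>Induction on the last ternary digit. A final 2 raises both exponents by 1, because
  \<open>n + 1\<close> becomes \<open>3 * (m + 1)\<close>; a final 1 corresponds to
  \<open>b = 0 < r\<close>; a final 0 occurs only for \<open>n = 0\<close>, with both exponents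
  0.\<close>

lemma T_mod_3_nonzero_iff: "T n mod 3 \<noteq> 0 \<longleftrightarrow> (\<exists>r b. b \<le> r \<and> 2 * (n + 1) = 3 ^ r + 3 ^ b)"
proof (induction n rule: less_induct)
  case (less n)
  let ?P = "\<lambda>n r b. b \<le> r \<and> 2 * (n + 1) = 3 ^ r + (3 ^ b :: nat)"
  have low: "(n + 1) mod 3 \<noteq> 0" if "?P n r 0" "r \<noteq> 0" for n r
  proof -
    obtain q where "r = Suc q" using \<open>r \<noteq> 0\<close> by (cases r) auto
    then have "\<exists>k. 2 * (n + 1) = 3 * k + 1" using that by (intro exI[of _ "3 ^ q"]) simp
    then show ?thesis by presburger
  qed
  have high: "(n + 1) mod 3 = 0" if "?P n r b" "b \<noteq> 0" for n r b
  proof -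
    have "0 < r" "0 < b" using that by auto
    then obtain q q' where "r = Suc q" "b = Suc q'" unfolding gr0_conv_Suc by blast
    then have "\<exists>k. 2 * (n + 1) = 3 * k"
      using that by (intro exI[of _ "3 ^ q + 3 ^ q'"]) simp
    then show ?thesis by presburger
  qed
  consider "n = 0" | m where "n = 3 * m" "m > 0" | m where "n = 3 * m + 1" | m where "n = 3 * m + 2"
  proof -
    have "n = 3 * (n div 3) \<or> n = 3 * (n div 3) + 1 \<or> n = 3 * (n div 3) + 2" by presburger
    then show thesis using that by (metis gr0I mult_0_right)
  qed
  then show ?case
  proof cases
    case 1
    have "?P 0 0 0" by simp
    then show ?thesis unfolding 1 by (metis T_0 mod_less one_less_numeral_iff semiring_norm(77) zero_neq_one)
  next
    case 2
    \<comment> \<open>Here \<open>2 * (n + 1)\<close> is 2 modulo 3, whereas the sum of powers is 1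
      for \<open>b = 0 < r\<close>, and 0 for \<open>b > 0\<close>.\<close>
    have False if P: "?P n r b" for r b
    proof (cases "b = 0")
      case True
      then have "r \<noteq> 0" using P 2 True by (intro notI) auto
      then obtain q where "r = Suc q" by (cases r) auto
      then have "\<exists>k. 2 * (3 * m + 1) = 3 * k + (1::nat)"
        using P 2 True by (intro exI[of _ "3 ^ q"]) simp
      then show False by presburger
    next
      case False
      with high[OF P] 2 show False by presburger
    qed
    then show ?thesis using T_3m_mod_3 2 by auto
  next
    case 3
    have "(\<exists>r. 2 * m + 1 = 3 ^ r) \<longleftrightarrow> (\<exists>r b. ?P n r b)"
    proof
      assume "\<exists>r. 2 * m + 1 = 3 ^ r"
      then obtain r where "2 * m + 1 = 3 ^ r" by blast
      then have "?P n (Suc r) 0" using 3 by simp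
      then show "\<exists>r b. ?P n r b" by blast
    next
      assume "\<exists>r b. ?P n r b"
      then obtain r b where P: "?P n r b" by blast
      have "b = 0" using high[OF P] 3 by presburger
      moreover have "r \<noteq> 0" using P 3 \<open>b = 0\<close> by (intro notI) auto
      ultimately obtain q where "r = Suc q" by (cases r) auto
      then have "2 * m + 1 = 3 ^ q" using P \<open>b = 0\<close> 3 by simp
      then show "\<exists>r. 2 * m + 1 = 3 ^ r" by blast
    qed
    then show ?thesis using T_3m_1_mod_3 3 by simp
  next
    case 4
    have "(\<exists>r b. ?P m r b) \<longleftrightarrow> (\<exists>r b. ?P n r b)"
    proof
      assume "\<exists>r b. ?P m r b"
      then obtain r b where "?P m r b" by blast
      then have "?P n (Suc r) (Suc b)" using 4 by simp
      then show "\<exists>r b. ?P n r b" by blast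
    next
      assume "\<exists>r b. ?P n r b"
      then obtain r b where P: "?P n r b" by blast
      have "b \<noteq> 0"
      proof
        assume "b = 0"
        then have "r \<noteq> 0" using P 4 \<open>b = 0\<close> by (intro notI) auto
        then show False using low[of r n] P \<open>b = 0\<close> 4 by (simp add: mod_Suc)
      qed
      then have "0 < r" "0 < b" using P by auto
      then obtain q q' where "r = Suc q" "b = Suc q'" unfolding gr0_conv_Suc by blast
      then have "?P m q q'" using P 4 by simp
      then show "\<exists>r b. ?P m r b" by blast
    qed
    then show ?thesis using T_3m_2_mod_3 less.IH[of m] 4 by simp
  qed
qed

section \<open>Zero runs\<close>

definition consecutive_nonzeros :: "nat \<Rightarrow> nat \<Rightarrow> nat \<Rightarrow> bool" where
  "consecutive_nonzeros p s t \<longleftrightarrow> s < t \<and> T s mod p \<noteq> 0 \<and> T t mod p \<noteq> 0 \<and> (\<forall>n\<in>{s<..<t}. T n mod p = 0)"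

text \<open>An interval through \<open>x\<close> that leaves the gap would contain \<open>s\<close>
  or \<open>t\<close>, where \<open>T\<close> is nonzero modulo \<open>p\<close>.\<close>

lemma zero_interval_subset_gap:
  assumes "consecutive_nonzeros p s t" "zero_interval p J" "x \<in> J" "s < x" "x < t"
  shows "J \<subseteq> {s<..<t}"
proof
  fix y assume "y \<in> J"
  then have "{x..y} \<subseteq> J" "{y..x} \<subseteq> J" and z: "\<forall>n\<in>J. T n mod p = 0"
    using assms unfolding zero_interval_def by auto
  moreover have "s \<notin> J" "t \<notin> J" using assms(1) z unfolding consecutive_nonzeros_def by auto
  ultimately have "s \<notin> {y..x}" "t \<notin> {x..y}" by auto
  then show "y \<in> {s<..<t}" using assms by auto
qed

lemma zero_interval_gap:
  assumes "consecutive_nonzeros p s t" "s + 1 < t"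
  shows "zero_interval p {s<..<t}"
proof -
  have "s + 1 \<in> {s<..<t}" using assms by simp
  then show ?thesis using assms unfolding zero_interval_def consecutive_nonzeros_def by fastforce
qed

lemma zero_run_gap:
  assumes "consecutive_nonzeros p s t" "s + 1 < t"
  shows "zero_run p {s<..<t}"
  unfolding zero_run_def
proof (intro conjI allI impI)
  fix J assume J: "zero_interval p J \<and> {s<..<t} \<subseteq> J"
  then have "s + 1 \<in> J" using assms by auto
  then show "J = {s<..<t}" using zero_interval_subset_gap[OF assms(1), of J "s + 1"] J assms by auto
qed (rule zero_interval_gap[OF assms])

lemma zero_run_eq_gap:
  assumes "zero_run p I" "consecutive_nonzeros p s t" "x \<in> I" "s < x" "x < t"
  shows "I = {s<..<t}"
proof -
  have "zero_interval p I" and maximal: "\<And>J. zero_interval p J \<Longrightarrow> I \<subseteq> J \<Longrightarrow> J = I"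
    using assms(1) by (auto simp: zero_run_def)
  then have "I \<subseteq> {s<..<t}"
    using zero_interval_subset_gap[OF assms(2) _ assms(3-5)] by simp
  moreover have "zero_interval p {s<..<t}"
    using assms(4,5) by (intro zero_interval_gap[OF assms(2)]) simp
  ultimately show ?thesis using maximal[of "{s<..<t}"] by simp
qed

lemma Least_gap: "s + 1 < t \<Longrightarrow> (LEAST n. n \<in> {s<..<t}) = s + 1" for s t :: nat
  by (rule Least_equality) auto

text \<open>The union of two runs with a common least element is again a zero interval, so
  maximality makes both equal to it.\<close>

lemma zero_run_Least_unique:
  assumes "zero_run p I" "zero_run p J" "(LEAST n. n \<in> I) = (LEAST n. n \<in> J)"
  shows "I = J"
proof -
  have ne: "I \<noteq> {}" "J \<noteq> {}" using assms unfolding zero_run_def zero_interval_def by auto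
  define x where "x = (LEAST n. n \<in> I)"
  have x: "x \<in> I" "x \<in> J"
    using ne assms(3) LeastI_ex[of "\<lambda>n. n \<in> I"] LeastI_ex[of "\<lambda>n. n \<in> J"] by (auto simp: x_def)
  have le: "x \<le> y" if "y \<in> I \<union> J" for y
    using that assms(3) by (auto simp: x_def intro: Least_le) (metis Least_le)
  have zi: "zero_interval p I" "zero_interval p J" using assms unfolding zero_run_def by auto
  have "zero_interval p (I \<union> J)"
    unfolding zero_interval_def
  proof (intro conjI ballI)
    fix a b assume "a \<in> I \<union> J" "b \<in> I \<union> J"
    \<comment> \<open>The common least element \<open>x\<close> lies in whichever run contains
      \<open>b\<close>.\<close>
    then have "{a..b} \<subseteq> {x..b}" "{x..b} \<subseteq> I \<or> {x..b} \<subseteq> J"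
      using le[of a] x zi unfolding zero_interval_def by (simp, blast)
    then show "{a..b} \<subseteq> I \<union> J" by blast
  qed (use ne zi in \<open>auto simp: zero_interval_def\<close>)
  then have "I \<union> J = I" "I \<union> J = J" using assms unfolding zero_run_def by blast+
  then show ?thesis by simp
qed

section \<open>Records in the enumeration of zero runs\<close>

context
  fixes p :: nat
  assumes infinite_starts: "infinite {LEAST n. n \<in> J | J. zero_run p J}"
begin

lemma ith_zero_run_props:
  "zero_run p (ith_zero_run p i)"
  "(LEAST n. n \<in> ith_zero_run p i) = enumerate {LEAST n. n \<in> J | J. zero_run p J} (i - 1)"
proof -
  have "enumerate {LEAST n. n \<in> J | J. zero_run p J} (i - 1) \<in> {LEAST n. n \<in> J | J. zero_run p J}"
    by (rule enumerate_in_set[OF infinite_starts])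
  then obtain I where I: "zero_run p I \<and>
      (LEAST n. n \<in> I) = enumerate {LEAST n. n \<in> J | J. zero_run p J} (i - 1)" by auto
  then have "zero_run p (ith_zero_run p i) \<and>
      (LEAST n. n \<in> ith_zero_run p i) = enumerate {LEAST n. n \<in> J | J. zero_run p J} (i - 1)"
    unfolding ith_zero_run_def by (rule theI) (use zero_run_Least_unique I in force)
  then show "zero_run p (ith_zero_run p i)"
    "(LEAST n. n \<in> ith_zero_run p i) = enumerate {LEAST n. n \<in> J | J. zero_run p J} (i - 1)" by auto
qed

lemma record_of_longest_so_far:
  assumes "zero_run p J"
    and longest: "\<And>I. zero_run p I \<Longrightarrow> (LEAST n. n \<in> I) < (LEAST n. n \<in> J) \<Longrightarrow> card I \<le> card J"
  shows "\<exists>k. left_to_right_max (zero_run_length p) k \<and> zero_run_length p k = card J"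
proof -
  let ?L = "{LEAST n. n \<in> J | J. zero_run p J}"
  \<comment> \<open>\<open>enumerate\<close> counts from 0, so \<open>J\<close> is run number
    \<open>m + 1\<close>.\<close>
  obtain m where m: "enumerate ?L m = (LEAST n. n \<in> J)"
    using enumerate_Ex[of ?L "LEAST n. n \<in> J"] infinite_starts assms(1) by blast
  have J: "ith_zero_run p (m + 1) = J"
    using zero_run_Least_unique[OF ith_zero_run_props(1)[of "m + 1"] assms(1)] ith_zero_run_props(2)[of "m + 1"] m
    by simp
  have "card (ith_zero_run p i) \<le> card J" if "1 \<le> i" "i < m + 1" for i
  proof (rule longest[OF ith_zero_run_props(1)])
    have "enumerate ?L (i - 1) < enumerate ?L m"
      by (rule enumerate_mono[OF _ infinite_starts]) (use that in simp)
    then show "(LEAST n. n \<in> ith_zero_run p i) < (LEAST n. n \<in> J)"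
      unfolding ith_zero_run_props(2) m .
  qed
  then have "left_to_right_max (zero_run_length p) (m + 1)"
    unfolding left_to_right_max_def zero_run_length_def J by simp
  then show ?thesis using J unfolding zero_run_length_def by blast
qed

end

section \<open>Zero runs modulo 3\<close>

text \<open>For \<open>b \<le> r\<close>, this is the number with ternary digits
  \<open>r - b\<close> ones followed by \<open>b\<close> twos. The division is exact since both
  powers are odd.\<close>

definition nonzero_index :: "nat \<Rightarrow> nat \<Rightarrow> nat" where
  "nonzero_index r b = (3 ^ r + 3 ^ b) div 2 - 1"

lemma nonzero_index_eq: "2 * (nonzero_index r b + 1) = 3 ^ r + 3 ^ b"
proof -
  have "even (3 ^ r + 3 ^ b :: nat)" by simp
  then obtain k :: nat where k: "3 ^ r + 3 ^ b = 2 * k" by (rule evenE)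
  have "(3 ^ r + 3 ^ b :: nat) > 0" by simp
  then have "k > 0" unfolding k by simp
  then show ?thesis unfolding nonzero_index_def k by simp
qed

lemma T_nonzero_index: "b \<le> r \<Longrightarrow> T (nonzero_index r b) mod 3 \<noteq> 0"
  unfolding T_mod_3_nonzero_iff using nonzero_index_eq[of r b] by blast

lemma nonzero_indexE:
  assumes "T n mod 3 \<noteq> 0"
  obtains r b where "b \<le> r" "n = nonzero_index r b"
proof -
  obtain r b where "b \<le> r" "2 * (n + 1) = 3 ^ r + 3 ^ b"
    using assms unfolding T_mod_3_nonzero_iff by blast
  moreover from this have "n = nonzero_index r b"
    unfolding nonzero_index_eq[symmetric] by simp
  ultimately show thesis using that by simp
qed

lemma pow3_le: "a \<le> b \<Longrightarrow> (3::nat) ^ a \<le> 3 ^ b"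
  by (rule power_increasing) auto

lemma pow3_Suc_le: "a < b \<Longrightarrow> 3 * (3::nat) ^ a \<le> 3 ^ b"
  using pow3_le[of "Suc a" b] by simp

lemma consecutive_same_r:
  assumes "b < r"
  shows "consecutive_nonzeros 3 (nonzero_index r b) (nonzero_index r (Suc b))"
  unfolding consecutive_nonzeros_def
proof (intro conjI ballI)
  show "nonzero_index r b < nonzero_index r (Suc b)"
  proof -
    have "2 * (nonzero_index r b + 1) < 2 * (nonzero_index r (Suc b) + 1)"
      unfolding nonzero_index_eq by simp
    then show ?thesis by simp
  qed
next
  fix n assume n: "n \<in> {nonzero_index r b<..<nonzero_index r (Suc b)}"
  show "T n mod 3 = 0"
  proof (rule ccontr)
    assume "T n mod 3 \<noteq> 0"
    then obtain r' b' where *: "b' \<le> r'" "n = nonzero_index r' b'" by (rule nonzero_indexE)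
    have lo: "3 ^ r + 3 ^ b < (3 ^ r' + 3 ^ b' :: nat)" and hi: "3 ^ r' + 3 ^ b' < (3 ^ r + 3 * 3 ^ b :: nat)"
      using n * nonzero_index_eq[of r b] nonzero_index_eq[of r "Suc b"] nonzero_index_eq[of r' b'] by auto
    \<comment> \<open>A smaller \<open>r'\<close> makes the sum less than \<open>3 ^ r\<close>, a
      larger one makes it at least \<open>3 * 3 ^ r\<close>, and equality would put
      \<open>3 ^ b'\<close> strictly between consecutive powers of 3.\<close>
    consider "r' < r" | "r < r'" | "r = r'" by linarith
    then show False
    proof cases
      case 1 then show False using pow3_Suc_le[of r' r] pow3_le[of b' r'] * lo by linarith
    next
      case 2 then show False using pow3_Suc_le[of r r'] pow3_Suc_le[of b r] assms hi by linarith
    next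
      case 3 then show False using lo hi pow3_Suc_le[of b b'] pow3_le[of b' b]
        by (cases "b' \<le> b") auto
    qed
  qed
qed (rule T_nonzero_index; use assms in simp)+

lemma consecutive_next_r: "consecutive_nonzeros 3 (nonzero_index r r) (nonzero_index (Suc r) 0)"
  unfolding consecutive_nonzeros_def
proof (intro conjI ballI)
  show "nonzero_index r r < nonzero_index (Suc r) 0"
    using nonzero_index_eq[of r r] nonzero_index_eq[of "Suc r" 0] by simp
next
  fix n assume n: "n \<in> {nonzero_index r r<..<nonzero_index (Suc r) 0}"
  show "T n mod 3 = 0"
  proof (rule ccontr)
    assume "T n mod 3 \<noteq> 0"
    then obtain r' b' where *: "b' \<le> r'" "n = nonzero_index r' b'" by (rule nonzero_indexE)
    have lo: "2 * 3 ^ r < (3 ^ r' + 3 ^ b' :: nat)" and hi: "3 ^ r' + 3 ^ b' < (3 * 3 ^ r + 1 :: nat)"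
      using n * nonzero_index_eq[of r r] nonzero_index_eq[of "Suc r" 0] nonzero_index_eq[of r' b'] by auto
    show False
    \<comment> \<open>The sum is at most \<open>2 * 3 ^ r\<close> in the first case and at least
      \<open>3 * 3 ^ r + 1\<close> in the second.\<close>
    proof (cases "r' \<le> r")
      case True then show False using pow3_le[of r' r] pow3_le[of b' r'] * lo by linarith
    next
      case False
      moreover have "(3::nat) ^ b' > 0" by simp
      ultimately show False using pow3_Suc_le[of r r'] hi by linarith
    qed
  qed
qed (rule T_nonzero_index; simp)+

text \<open>The gap up to the next nonzero index. It is empty for \<open>b = 0\<close>, so it is a
  zero run only for \<open>b \<ge> 1\<close>.\<close>

definition run_after :: "nat \<Rightarrow> nat \<Rightarrow> nat set" where
  "run_after r b =
    {nonzero_index r b<..<(if b < r then nonzero_index r (Suc b) else nonzero_index (Suc r) 0)}"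

lemma card_run_after: "b < r \<Longrightarrow> card (run_after r b) = 3 ^ b - 1"
  "card (run_after r r) = (3 ^ r - 1) div 2"
proof -
  show "b < r \<Longrightarrow> card (run_after r b) = 3 ^ b - 1"
    using nonzero_index_eq[of r b] nonzero_index_eq[of r "Suc b"] by (simp add: run_after_def)
  show "card (run_after r r) = (3 ^ r - 1) div 2"
    using nonzero_index_eq[of r r] nonzero_index_eq[of "Suc r" 0] by (simp add: run_after_def)
qed

lemma zero_run_after:
  assumes "1 \<le> b" "b \<le> r"
  shows "zero_run 3 (run_after r b)"
    and "(LEAST n. n \<in> run_after r b) = nonzero_index r b + 1"
proof -
  let ?t = "if b < r then nonzero_index r (Suc b) else nonzero_index (Suc r) 0"
  have cons: "consecutive_nonzeros 3 (nonzero_index r b) ?t"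
    using consecutive_same_r consecutive_next_r[of r] assms by auto
  have "3 \<le> (3::nat) ^ b" using pow3_le[OF assms(1)] by simp
  then have less: "nonzero_index r b + 1 < ?t"
    using nonzero_index_eq[of r b] nonzero_index_eq[of r "Suc b"] nonzero_index_eq[of "Suc r" 0] assms
    by (cases "b = r") auto
  show "zero_run 3 (run_after r b)" "(LEAST n. n \<in> run_after r b) = nonzero_index r b + 1"
    unfolding run_after_def using zero_run_gap[OF cons less] Least_gap[OF less] by auto
qed

lemma zero_run_3E:
  assumes "zero_run 3 I"
  obtains r b where "1 \<le> b" "b \<le> r" "I = run_after r b"
proof -
  have "I \<noteq> {}" "\<forall>n\<in>I. T n mod 3 = 0"
    using assms by (simp_all add: zero_run_def zero_interval_def)
  then obtain x where x: "x \<in> I" "T x mod 3 = 0" by auto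
  \<comment> \<open>The last nonzero index up to \<open>x\<close> exists because
    \<open>T 0 = 1\<close>; its successor among the nonzero indices lies beyond
    \<open>x\<close>.\<close>
  define s where "s = (GREATEST n. n \<le> x \<and> T n mod 3 \<noteq> 0)"
  have ex: "0 \<le> x \<and> T 0 mod 3 \<noteq> 0" by (simp add: T_0)
  have s: "s \<le> x \<and> T s mod 3 \<noteq> 0"
    unfolding s_def using ex by (rule GreatestI_nat[where b = x]) auto
  have greatest: "n \<le> s" if "n \<le> x" "T n mod 3 \<noteq> 0" for n
    unfolding s_def using that by (intro Greatest_le_nat[where b = x]) auto
  obtain r b where rb: "b \<le> r" "s = nonzero_index r b"
    by (rule nonzero_indexE[OF conjunct2[OF s]])
  define t where "t = (if b < r then nonzero_index r (Suc b) else nonzero_index (Suc r) 0)"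
  have cons: "consecutive_nonzeros 3 s t"
    using consecutive_same_r consecutive_next_r[of r] rb unfolding t_def by auto
  have "s < x" using s x by (metis le_neq_implies_less)
  moreover have "x < t" using greatest[of t] cons unfolding consecutive_nonzeros_def by force
  ultimately have I: "I = {s<..<t}" using zero_run_eq_gap assms x cons by blast
  have "b \<noteq> 0"
  proof
    assume "b = 0"
    then have "card (run_after r b) = 0"
      using card_run_after(1)[of b r] card_run_after(2)[of r] rb by (cases "b < r") auto
    moreover have "x \<in> run_after r b"
      unfolding run_after_def using \<open>s < x\<close> \<open>x < t\<close> rb by (simp add: t_def)
    ultimately show False by (auto simp: run_after_def)
  qed
  then show thesis using that[of b r] rb I unfolding run_after_def t_def by auto
qed

text \<open>The runs \<open>run_after r r\<close> with \<open>r \<ge> 1\<close> already have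
  distinct starts.\<close>

lemma infinite_zero_run_3_starts: "infinite {LEAST n. n \<in> J | J. zero_run 3 J}"
proof -
  have "inj (\<lambda>r. nonzero_index (Suc r) (Suc r) + 1)"
  proof (rule injI)
    fix x y assume "nonzero_index (Suc x) (Suc x) + 1 = nonzero_index (Suc y) (Suc y) + 1"
    then show "x = y" using nonzero_index_eq[of "Suc x" "Suc x"] nonzero_index_eq[of "Suc y" "Suc y"]
      by simp
  qed
  then have "infinite (range (\<lambda>r. nonzero_index (Suc r) (Suc r) + 1))" by (rule range_inj_infinite)
  moreover have "nonzero_index (Suc r) (Suc r) + 1 \<in> {LEAST n. n \<in> J | J. zero_run 3 J}" for r
    using zero_run_after[of "Suc r" "Suc r"] by force
  ultimately show ?thesis by (meson finite_subset image_subsetI)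
qed

section \<open>The left-to-right maxima modulo 3\<close>

lemma zero_run_before:
  assumes "zero_run 3 I" "(LEAST n. n \<in> I) < nonzero_index r b + 1"
  obtains r' b' where "1 \<le> b'" "b' \<le> r'" "I = run_after r' b'" "3 ^ r' + 3 ^ b' < (3 ^ r + 3 ^ b :: nat)"
proof -
  obtain r' b' where *: "1 \<le> b'" "b' \<le> r'" "I = run_after r' b'" using zero_run_3E[OF assms(1)] .
  then have "nonzero_index r' b' < nonzero_index r b" using assms(2) zero_run_after(2) by simp
  then have "3 ^ r' + 3 ^ b' < (3 ^ r + 3 ^ b :: nat)"
    unfolding nonzero_index_eq[symmetric] by simp
  then show thesis using that * by blast
qed

lemma record_half:
  assumes "1 \<le> r"
  shows "\<exists>k. left_to_right_max (zero_run_length 3) k \<and> zero_run_length 3 k = (3 ^ r - 1) div 2"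
  unfolding card_run_after(2)[symmetric]
proof (rule record_of_longest_so_far[OF infinite_zero_run_3_starts])
  fix I assume I: "zero_run 3 I" "(LEAST n. n \<in> I) < (LEAST n. n \<in> run_after r r)"
  then have "(LEAST n. n \<in> I) < nonzero_index r r + 1"
    using zero_run_after(2)[of r r] assms by simp
  then obtain r' b' where *: "1 \<le> b'" "b' \<le> r'" "I = run_after r' b'"
      and less: "3 ^ r' + 3 ^ b' < (3 ^ r + 3 ^ r :: nat)"
    by (rule zero_run_before[OF I(1)])
  have r': "r' \<le> r" using pow3_Suc_le[of r r'] less by (cases "r' \<le> r") auto
  show "card I \<le> card (run_after r r)"
  proof (cases "b' < r'")
    case True
    \<comment> \<open>As \<open>b' < r' \<le> r\<close>, the length \<open>3 ^ b' - 1\<close> is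
      even below a third of \<open>3 ^ r\<close>, hence at most
      \<open>(3 ^ r - 1) div 2\<close>.\<close>
    then have "3 * 3 ^ b' \<le> (3 ^ r :: nat)" using r' by (intro pow3_Suc_le) simp
    then show ?thesis using * True by (simp add: card_run_after)
  next
    case False
    then have "b' = r'" using * by simp
    moreover have "(3 ^ r' - 1) div 2 \<le> (3 ^ r - 1 :: nat) div 2"
      using pow3_le[OF r'] by (intro div_le_mono diff_le_mono)
    ultimately show ?thesis using * by (simp add: card_run_after)
  qed
qed (use assms zero_run_after in auto)

lemma record_full:
  assumes "1 \<le> b"
  shows "\<exists>k. left_to_right_max (zero_run_length 3) k \<and> zero_run_length 3 k = 3 ^ b - 1"
  \<comment> \<open>Among the pairs \<open>(r, b)\<close> with \<open>b < r\<close>, the earliest is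
    chosen: \<open>r = Suc b\<close>.\<close>
  unfolding card_run_after(1)[OF lessI, symmetric]
proof (rule record_of_longest_so_far[OF infinite_zero_run_3_starts])
  fix I assume I: "zero_run 3 I" "(LEAST n. n \<in> I) < (LEAST n. n \<in> run_after (Suc b) b)"
  then have "(LEAST n. n \<in> I) < nonzero_index (Suc b) b + 1"
    using zero_run_after(2)[of b "Suc b"] assms by simp
  then obtain r' b' where *: "1 \<le> b'" "b' \<le> r'" "I = run_after r' b'"
      and less: "3 ^ r' + 3 ^ b' < (3 ^ Suc b + 3 ^ b :: nat)"
    by (rule zero_run_before[OF I(1)])
  have r': "r' \<le> Suc b" using pow3_Suc_le[of "Suc b" r'] less by (cases "r' \<le> Suc b") auto
  show "card I \<le> card (run_after (Suc b) b)"
  proof (cases "b' < r'")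
    case True
    then have "3 ^ b' - 1 \<le> (3 ^ b - 1 :: nat)" using r' by (intro diff_le_mono pow3_le) simp
    then show ?thesis using * True by (simp add: card_run_after)
  next
    case False
    then have eq: "b' = r'" using * by simp
    \<comment> \<open>The long gap after \<open>(Suc b, Suc b)\<close> comes only later, so an
      earlier diagonal pair has \<open>r' \<le> b\<close>.\<close>
    have "r' \<noteq> Suc b" using less eq by auto
    then have "3 ^ r' - 1 \<le> (3 ^ b - 1 :: nat)" using r' by (intro diff_le_mono pow3_le) simp
    then have "(3 ^ r' - 1) div 2 \<le> (3 ^ b - 1 :: nat)" by (rule order_trans[OF div_le_dividend])
    then show ?thesis using * eq by (simp add: card_run_after)
  qed
qed (use assms zero_run_after in auto)

theorem theorem4p3:
  shows "{zero_run_length 3 k | k. left_to_right_max (zero_run_length 3) k} =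
    {(3 ^ r - 1) div 2 | r :: nat. r \<ge> 1} \<union> {3 ^ r - 1 | r :: nat. r \<ge> 1}"
proof (intro subset_antisym subsetI)
  fix l assume "l \<in> {zero_run_length 3 k | k. left_to_right_max (zero_run_length 3) k}"
  then obtain k where l: "l = card (ith_zero_run 3 k)" unfolding zero_run_length_def by blast
  obtain r b where rb: "1 \<le> b" "b \<le> r" "ith_zero_run 3 k = run_after r b"
    by (rule zero_run_3E[OF ith_zero_run_props(1)[OF infinite_zero_run_3_starts]])
  \<comment> \<open>The two forms correspond to \<open>b = r\<close> and \<open>b < r\<close>;
    \<open>1 \<le> b \<le> r\<close> makes either exponent admissible.\<close>
  then have "l = (3 ^ r - 1) div 2 \<or> l = 3 ^ b - 1"
    using l card_run_after by (cases "b < r") auto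
  then show "l \<in> {(3 ^ r - 1) div 2 | r :: nat. r \<ge> 1} \<union> {3 ^ r - 1 | r :: nat. r \<ge> 1}"
    using rb by auto
next
  fix l :: nat
  assume "l \<in> {(3 ^ r - 1) div 2 | r :: nat. r \<ge> 1} \<union> {3 ^ r - 1 | r :: nat. r \<ge> 1}"
  then show "l \<in> {zero_run_length 3 k | k. left_to_right_max (zero_run_length 3) k}"
  proof
    assume "l \<in> {(3 ^ r - 1) div 2 | r :: nat. r \<ge> 1}"
    then obtain r where "r \<ge> 1" "l = (3 ^ r - 1) div 2" by auto
    then obtain k where "left_to_right_max (zero_run_length 3) k" "zero_run_length 3 k = l"
      using record_half[of r] by blast
    then show ?thesis by blast
  next
    assume "l \<in> {3 ^ r - 1 | r :: nat. r \<ge> 1}"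
    then obtain r where "r \<ge> 1" "l = 3 ^ r - 1" by auto
    then obtain k where "left_to_right_max (zero_run_length 3) k" "zero_run_length 3 k = l"
      using record_full[of r] by blast
    then show ?thesis by blast
  qed
qed

end
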